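(* Let $a^*>0$ and suppose that $t_f^*$ is a solution (the attained minimal length) of Problem (MD) with curvature bound $a=a^*$ fixed. Then $a^*$ is a solution (the attained minimal curvature bound) of Problem (Pc) with length $t_f=t_f^*$ fixed and the same endpoint data.
   Context: Fix endpoint data $(x_0,y_0,\theta_0),(x_f,y_f,\theta_f)\in\mathbb R^3$. Consider the constraints on $(x,y,\theta,u)$ on $[0,t_f]$, with $x,y,\theta$ absolutely continuous and $u\in L^\infty(0,t_f;\mathbb R)$: $$\dot x=\cos\theta,\quad \dot y=\sin\theta,\quad \dot\theta=u,\quad |u(t)|\le a\ \text{ for a.e. } t\in[0,t_f],$$ $$(x,y,\theta)(0)=(x_0,y_0,\theta_0),\qquad (x,y,\theta)(t_f)=(x_f,y_f,\theta_f),$$ where angles at the endpoints are understood modulo $2\pi$ (only the directions of the velocity vectors at the endpoints are prescribed). Problem (Pc): with $t_f$ fixed, minimize $a\ge 0$ over $a$ and $u$ subject to these constraints. Problem (MD) (Markov--Dubins): with $a$ fixed, minimize $t_f$ over $t_f$ and $u$ subject to these constraints. Standing assumption for Problem (Pc): $t_f>\|(x_0,y_0)-(x_f,y_f)\|$; in particular here $t_f^*>\|(x_0,y_0)-(x_f,y_f)\|$. *)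

theory Defs
  imports "HOL-Analysis.Analysis" "HOL-Library.Real_Mod"
begin

text \<open>
  Absolute continuity of a function on a real interval. The constant \<open>absolutely_continuous\<close> of
  HOL-Analysis is the unrelated notion for measures.
\<close>

definition abs_cont_on :: "real set \<Rightarrow> (real \<Rightarrow> real) \<Rightarrow> bool" where
  "abs_cont_on I f \<longleftrightarrow>
     (\<forall>\<epsilon>>0. \<exists>\<delta>>0. \<forall>D :: (real \<times> real) set.
        finite D \<and> (\<forall>(s, t)\<in>D. s \<le> t \<and> {s..t} \<subseteq> I) \<and>
        disjoint_family_on (\<lambda>(s, t). {s<..<t}) D \<and> (\<Sum>(s, t)\<in>D. t - s) < \<delta>
        \<longrightarrow> (\<Sum>(s, t)\<in>D. \<bar>f t - f s\<bar>) < \<epsilon>)"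

definition Linfty_on :: "real set \<Rightarrow> (real \<Rightarrow> real) \<Rightarrow> bool" where
  "Linfty_on I u \<longleftrightarrow>
     u \<in> borel_measurable (lebesgue_on I) \<and> (\<exists>C. AE t in lebesgue_on I. \<bar>u t\<bar> \<le> C)"

text \<open>
  The constraints shared by both problems; \<open>p0\<close> and \<open>pf\<close> are the endpoint data
  \<open>(x0, y0, \<theta>0)\<close> and \<open>(xf, yf, \<theta>f)\<close>. The differential equations hold almost everywhere,
  and the angle \<open>\<theta>\<close> itself is real-valued, matching the endpoint angles modulo \<open>2 * pi\<close>.
\<close>

definition dubins_constraints ::
  "real \<times> real \<times> real \<Rightarrow> real \<times> real \<times> real \<Rightarrow> real \<Rightarrow> real \<Rightarrow>
   (real \<Rightarrow> real) \<Rightarrow> (real \<Rightarrow> real) \<Rightarrow> (real \<Rightarrow> real) \<Rightarrow> (real \<Rightarrow> real) \<Rightarrow> bool" where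
  "dubins_constraints p0 pf tf a x y \<theta> u \<longleftrightarrow>
     (case (p0, pf) of ((x0, y0, \<theta>0), (xf, yf, \<theta>f)) \<Rightarrow>
        abs_cont_on {0..tf} x \<and> abs_cont_on {0..tf} y \<and> abs_cont_on {0..tf} \<theta> \<and>
        Linfty_on {0..tf} u \<and>
        (AE t in lebesgue_on {0..tf}.
           (x has_real_derivative cos (\<theta> t)) (at t within {0..tf}) \<and>
           (y has_real_derivative sin (\<theta> t)) (at t within {0..tf}) \<and>
           (\<theta> has_real_derivative u t) (at t within {0..tf})) \<and>
        (AE t in lebesgue_on {0..tf}. \<bar>u t\<bar> \<le> a) \<and>
        x 0 = x0 \<and> y 0 = y0 \<and> [\<theta> 0 = \<theta>0] (rmod (2 * pi)) \<and>
        x tf = xf \<and> y tf = yf \<and> [\<theta> tf = \<theta>f] (rmod (2 * pi)))"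

text \<open>
  Both problems minimize the first component of a pair whose second component is the control; the
  control is determined only almost everywhere and determines the trajectory up to the choice of
  representative of the initial angle, so the trajectory is quantified existentially.
  An optimal value is a \<^emph>\<open>solution\<close> if it is attained by some control.
\<close>

definition Pc_feasible ::
  "real \<times> real \<times> real \<Rightarrow> real \<times> real \<times> real \<Rightarrow> real \<Rightarrow> real \<times> (real \<Rightarrow> real) \<Rightarrow> bool" where
  "Pc_feasible p0 pf tf = (\<lambda>(a, u). a \<ge> 0 \<and> (\<exists>x y \<theta>. dubins_constraints p0 pf tf a x y \<theta> u))"

definition Pc_solution ::
  "real \<times> real \<times> real \<Rightarrow> real \<times> real \<times> real \<Rightarrow> real \<Rightarrow> real \<Rightarrow> bool" where
  "Pc_solution p0 pf tf a \<longleftrightarrow> (\<exists>u. is_arg_min fst (Pc_feasible p0 pf tf) (a, u))"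

definition MD_feasible ::
  "real \<times> real \<times> real \<Rightarrow> real \<times> real \<times> real \<Rightarrow> real \<Rightarrow> real \<times> (real \<Rightarrow> real) \<Rightarrow> bool" where
  "MD_feasible p0 pf a = (\<lambda>(tf, u). tf > 0 \<and> (\<exists>x y \<theta>. dubins_constraints p0 pf tf a x y \<theta> u))"

definition MD_solution ::
  "real \<times> real \<times> real \<Rightarrow> real \<times> real \<times> real \<Rightarrow> real \<Rightarrow> real \<Rightarrow> bool" where
  "MD_solution p0 pf a tf \<longleftrightarrow> (\<exists>u. is_arg_min fst (MD_feasible p0 pf a) (tf, u))"

end

theory Submission
  imports Defs
begin

text \<open>
  Suppose that a curve of length \<open>tf\<close> joins the endpoint data with a curvature bound
  \<open>b < a\<close>. The slack between \<open>b\<close> and \<open>a\<close> can be traded for length: there is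
  then a strictly shorter curve with curvature at most \<open>a\<close>
  (\<open>shorter_curve_if_curvature_slack\<close>), so \<open>tf\<close> was not the minimal length for
  \<open>a\<close>. Since a minimizer for the length problem is itself admissible for the curvature problem,
  \<open>a\<close> is the minimal curvature bound for length \<open>tf\<close>.

  For the shorter curve, let \<open>\<theta>\<close> be the heading and \<open>\<Delta>\<close> the integral of
  \<open>cis \<circ> \<theta>\<close>, that is, the displacement from the initial to the final point. It is enough to
  change \<open>\<theta>\<close> a little, with fixed end values, so that the displacement becomes
  \<open>c *\<^sub>R \<Delta>\<close> for some \<open>c > 1\<close>: shrinking by the factor \<open>c\<close>
  restores the displacement, shortens the curve to \<open>tf / c\<close> and multiplies the curvature by
  \<open>c\<close>, which the slack absorbs (\<open>dubins_constraints_speed_up\<close>). Such a change exists because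
  the displacement is an open map of the variation near \<open>0\<close> (\<open>bent_displacement_interior\<close>):
  its derivative is onto the plane unless all normals \<open>\<i> * cis (\<theta> s)\<close> are parallel, and then
  the curve is a straight segment, which is excluded by the assumption that \<open>tf\<close> exceeds the distance of
  the endpoints.

  Admissible trajectories are only absolutely continuous and satisfy the equations almost everywhere. The passage from
  trajectories to headings therefore rests on the fundamental theorem of calculus for absolutely continuous functions
  (\<open>abs_cont_on_imp_has_integral_derivative\<close>), which also shows that headings are Lipschitz.
\<close>

section \<open>Absolutely continuous functions\<close>

lemma AE_lebesgue_on_iff_negligible:
  assumes "S \<in> sets lebesgue"
  shows "(AE t in lebesgue_on S. P t) \<longleftrightarrow> (\<exists>N. negligible N \<and> (\<forall>t\<in>S - N. P t))"
proof -
  have "(AE t in lebesgue_on S. P t) \<longleftrightarrow> (AE t in lebesgue. t \<in> S \<longrightarrow> P t)"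
    using assms by (subst AE_restrict_space_iff) auto
  also have "\<dots> \<longleftrightarrow> (\<exists>N. negligible N \<and> {t. \<not> (t \<in> S \<longrightarrow> P t)} \<subseteq> N)"
    by (simp add: eventually_ae_filter_negligible)
  finally show ?thesis by blast
qed

text \<open>
  Outer regularity of Lebesgue measure in the form in which it meets absolute continuity: the exceptional set is covered
  by an open set whose total length is below a prescribed \<open>\<delta>\<close>.
\<close>

lemma negligible_outer_open:
  assumes "negligible N" "\<delta> > 0"
  obtains U where "open U" "N \<subseteq> U" "U \<in> lmeasurable" "measure lebesgue U < \<delta>"
proof -
  have N: "N \<in> null_sets lebesgue"
    using assms(1) negligible_iff_null_sets by blast
  then have "N \<in> sets lebesgue" by blast
  from sets_lebesgue_outer_open[OF this assms(2)]
  obtain U where U: "open U" "N \<subseteq> U" "emeasure lebesgue (U - N) < ennreal \<delta>"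
    by metis
  have "emeasure lebesgue U < ennreal \<delta>"
    using U(3) N U(1) by (simp add: emeasure_Diff_null_set)
  moreover from this have "U \<in> lmeasurable"
    using U(1) by (intro fmeasurableI) (auto simp: order.strict_trans[OF _ ennreal_less_top])
  ultimately show ?thesis
    using that[OF U(1,2)] assms(2) by (simp add: emeasure_eq_measure2 ennreal_less_iff)
qed

text \<open>
  Differentiability at the tag \<open>t\<close> controls the increment over every small interval that contains
  \<open>t\<close>, because the increment splits at \<open>t\<close> into two one-sided ones. This is the local estimate
  on the intervals of a tagged division.
\<close>

lemma has_vector_derivative_straddle:
  fixes f :: "real \<Rightarrow> real"
  assumes "(f has_vector_derivative f') (at t within {a..b})" "\<epsilon> > 0"
  obtains d where "d > 0"
    "\<And>u v. \<lbrakk>u \<le> t; t \<le> v; u \<in> ball t d; v \<in> ball t d; u \<in> {a..b}; v \<in> {a..b}\<rbrakk>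
      \<Longrightarrow> \<bar>(v - u) * f' - (f v - f u)\<bar> \<le> \<epsilon> * (v - u)"
proof -
  from assms obtain d where d: "d > 0"
    "\<And>y. \<lbrakk>y \<in> {a..b}; norm (y - t) < d\<rbrakk> \<Longrightarrow> norm (f y - f t - (y - t) *\<^sub>R f') \<le> \<epsilon> * norm (y - t)"
    unfolding has_vector_derivative_def has_derivative_within_alt by blast
  show ?thesis
  proof (rule that[OF d(1)])
    fix u v assume uv: "u \<le> t" "t \<le> v" "u \<in> ball t d" "v \<in> ball t d" "u \<in> {a..b}" "v \<in> {a..b}"
    have "\<bar>f u - f t - (u - t) * f'\<bar> \<le> \<epsilon> * (t - u)" "\<bar>f v - f t - (v - t) * f'\<bar> \<le> \<epsilon> * (v - t)"
      using d(2)[of u] d(2)[of v] uv by (auto simp: dist_real_def)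
    then show "\<bar>(v - u) * f' - (f v - f u)\<bar> \<le> \<epsilon> * (v - u)"
      by (auto simp: algebra_simps abs_le_iff)
  qed
qed

lemma abs_cont_on_subset: "abs_cont_on J f \<Longrightarrow> I \<subseteq> J \<Longrightarrow> abs_cont_on I f"
  unfolding abs_cont_on_def by (smt (verit) case_prodD case_prodI2 order_trans)

lemma lipschitz_imp_abs_cont_on:
  assumes "C-lipschitz_on I f"
  shows "abs_cont_on I f"
  unfolding abs_cont_on_def
proof (intro allI impI)
  fix \<epsilon> :: real assume "\<epsilon> > 0"
  have "C \<ge> 0" using assms by (rule lipschitz_on_nonneg)
  show "\<exists>\<delta>>0. \<forall>D. finite D \<and> (\<forall>(s, t)\<in>D. s \<le> t \<and> {s..t} \<subseteq> I) \<and>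
      disjoint_family_on (\<lambda>(s, t). {s<..<t}) D \<and> (\<Sum>(s, t)\<in>D. t - s) < \<delta> \<longrightarrow>
      (\<Sum>(s, t)\<in>D. \<bar>f t - f s\<bar>) < \<epsilon>"
  proof (intro exI[of _ "\<epsilon> / (C + 1)"] conjI allI impI)
    show "\<epsilon> / (C + 1) > 0" using \<open>\<epsilon> > 0\<close> \<open>C \<ge> 0\<close> by simp
  next
    fix D assume D: "finite D \<and> (\<forall>(s, t)\<in>D. s \<le> t \<and> {s..t} \<subseteq> I) \<and>
      disjoint_family_on (\<lambda>(s, t). {s<..<t}) D \<and> (\<Sum>(s, t)\<in>D. t - s) < \<epsilon> / (C + 1)"
    have "(\<Sum>(s, t)\<in>D. \<bar>f t - f s\<bar>) \<le> (\<Sum>(s, t)\<in>D. C * (t - s))"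
    proof (rule sum_mono, clarify)
      fix s t assume "(s, t) \<in> D"
      then have st: "s \<le> t" "{s..t} \<subseteq> I" using D by auto
      then have "s \<in> I" "t \<in> I" by auto
      from lipschitz_onD[OF assms this(2,1)] show "\<bar>f t - f s\<bar> \<le> C * (t - s)"
        using st by (simp add: dist_real_def)
    qed
    also have "\<dots> = C * (\<Sum>(s, t)\<in>D. t - s)"
      by (simp add: sum_distrib_left case_prod_unfold)
    also have "\<dots> \<le> C * (\<epsilon> / (C + 1))"
      using D \<open>C \<ge> 0\<close> by (intro mult_left_mono) auto
    also have "\<dots> < \<epsilon>"
      using \<open>\<epsilon> > 0\<close> \<open>C \<ge> 0\<close> by (simp add: field_simps)
    finally show "(\<Sum>(s, t)\<in>D. \<bar>f t - f s\<bar>) < \<epsilon>" .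
  qed
qed

text \<open>
  Absolute continuity speaks about sets of endpoint pairs, the gauge integral about sets of tagged intervals. The two
  are translated into each other here; the length condition holds because all intervals lie in a set of small measure.
\<close>

lemma abs_cont_on_partial_division_bound:
  fixes f :: "real \<Rightarrow> real"
  assumes \<delta>: "\<forall>D. finite D \<and> (\<forall>(s, t)\<in>D. s \<le> t \<and> {s..t} \<subseteq> {a..b}) \<and>
        disjoint_family_on (\<lambda>(s, t). {s<..<t}) D \<and> (\<Sum>(s, t)\<in>D. t - s) < \<delta>
        \<longrightarrow> (\<Sum>(s, t)\<in>D. \<bar>f t - f s\<bar>) < \<epsilon>"
    and p: "p tagged_partial_division_of {a..b}"
    and U: "U \<in> lmeasurable" "measure lebesgue U < \<delta>"
    and pU: "\<And>x K. (x, K) \<in> p \<Longrightarrow> K \<subseteq> U"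
  shows "(\<Sum>(x, K)\<in>p. \<bar>f (Sup K) - f (Inf K)\<bar>) < \<epsilon>"
proof -
  define e where "e = (\<lambda>(x :: real, K :: real set). (Inf K, Sup K))"
  define D where "D = e ` p"
  have fin: "finite p"
    using tagged_partial_division_ofD(1)[OF p] .
  have interval: "\<exists>u v. K = {u..v} \<and> u \<le> v \<and> {u..v} \<subseteq> {a..b} \<and> e (x, K) = (u, v)"
    if "(x, K) \<in> p" for x K
  proof -
    from tagged_partial_division_ofD(4)[OF p that] obtain u v where "K = {u..v}" by auto
    then show ?thesis
      using tagged_partial_division_ofD(2,3)[OF p that] by (auto simp: e_def)
  qed
  have disj: "{s<..<t} \<inter> {s'<..<t'} = {}"
    if "(x, {s..t}) \<in> p" "(y, {s'..t'}) \<in> p" "(x, {s..t}) \<noteq> (y, {s'..t'})" for x y s t s' t'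
    using tagged_partial_division_ofD(5)[OF p that] by simp
  \<comment> \<open>One interval can carry several tags only if it is degenerate.\<close>
  have reindex: "(\<Sum>(s, t)\<in>D. h s t) = (\<Sum>(x, K)\<in>p. h (Inf K) (Sup K))"
    if h: "\<And>s. h s s = 0" for h :: "real \<Rightarrow> real \<Rightarrow> real"
  proof -
    have "(case e z of (s, t) \<Rightarrow> h s t) = 0"
      if zw: "z \<in> p" "w \<in> p" "z \<noteq> w" "e z = e w" for z w
    proof -
      obtain x K y L where eq: "z = (x, K)" "w = (y, L)" by fastforce
      obtain u v where uv: "K = {u..v}" "u \<le> v" "e z = (u, v)"
        using interval zw(1) eq by metis
      moreover have "L = {u..v}"
        using interval[of y L] zw uv eq by fastforce
      ultimately have "{u<..<v} = {}"
        using disj zw eq by fastforce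
      then show ?thesis
        using uv h by auto
    qed
    then have "(\<Sum>(s, t)\<in>D. h s t) = (\<Sum>z\<in>p. case e z of (s, t) \<Rightarrow> h s t)"
      unfolding D_def by (subst sum.reindex_nontrivial[OF fin]) auto
    then show ?thesis
      by (simp add: e_def case_prod_unfold)
  qed
  have "(\<Sum>(s, t)\<in>D. t - s) = (\<Sum>(x, K)\<in>p. Sup K - Inf K)"
    by (rule reindex) simp
  also have "\<dots> = (\<Sum>(x, K)\<in>p. measure lebesgue K)"
    by (rule sum.cong) (use interval in fastforce)+
  also have "\<dots> = (\<Sum>K\<in>snd ` p. measure lebesgue K)"
    by (rule sum.over_tagged_division_lemma[OF tagged_partial_division_of_Union_self[OF p]])
       (simp add: content_eq_0_interior)
  also have "\<dots> = measure lebesgue (\<Union>(snd ` p))"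
    by (rule content_division[OF partial_division_of_tagged_division[OF p]])
  also have "\<dots> \<le> measure lebesgue U"
  proof (rule measure_mono_fmeasurable)
    show "\<Union>(snd ` p) \<in> sets lebesgue"
      using partial_division_of_tagged_division[OF p] lmeasurable_division by blast
    show "\<Union>(snd ` p) \<subseteq> U" using pU by fastforce
  qed (fact U(1))
  finally have small: "(\<Sum>(s, t)\<in>D. t - s) < \<delta>"
    using U(2) by simp
  have "(\<Sum>(s, t)\<in>D. \<bar>f t - f s\<bar>) < \<epsilon>"
  proof (rule \<delta>[THEN spec, THEN mp], intro conjI small)
    show "finite D" using fin by (simp add: D_def)
    show "\<forall>(s, t)\<in>D. s \<le> t \<and> {s..t} \<subseteq> {a..b}"
      unfolding D_def using interval by fastforce
    show "disjoint_family_on (\<lambda>(s, t). {s<..<t}) D"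
      unfolding disjoint_family_on_def
    proof (intro ballI impI)
      fix m n assume mn: "m \<in> D" "n \<in> D" "m \<noteq> n"
      then obtain x K y L where xy: "(x, K) \<in> p" "(y, L) \<in> p" "m = e (x, K)" "n = e (y, L)"
        by (auto simp: D_def)
      then show "(case m of (s, t) \<Rightarrow> {s<..<t}) \<inter> (case n of (s, t) \<Rightarrow> {s<..<t}) = {}"
        using interval[OF xy(1)] interval[OF xy(2)] mn(3) disj by fastforce
    qed
  qed
  then show ?thesis
    by (subst (asm) reindex) auto
qed

text \<open>
  The fundamental theorem of calculus for absolutely continuous functions, proved directly from the gauge definition of
  the integral: at a tag outside \<open>N\<close> the gauge is small enough for the derivative to approximate the
  increment, at a tag in \<open>N\<close> it forces the interval into an open set of small measure, where absolute
  continuity bounds the sum of the increments.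
\<close>

theorem abs_cont_on_imp_has_integral_derivative:
  fixes f g :: "real \<Rightarrow> real"
  assumes "a \<le> b" and ac: "abs_cont_on {a..b} f" and N: "negligible N"
    and der: "\<And>t. t \<in> {a..b} - N \<Longrightarrow> (f has_vector_derivative g t) (at t within {a..b})"
  shows "(g has_integral (f b - f a)) {a..b}"
proof -
  (* On N the derivative g is unconstrained; replacing it by 0 there does not change the integral and
     leaves only the increments of f in the terms tagged in N. *)
  define g0 where "g0 t = (if t \<in> N then 0 else g t)" for t
  have "(g0 has_integral (f b - f a)) {a..b}"
    unfolding has_integral_real
  proof (intro allI impI)
    fix \<epsilon> :: real assume "\<epsilon> > 0"
    then obtain \<delta> where "\<delta> > 0" and \<delta>: "\<forall>D. finite D \<and> (\<forall>(s, t)\<in>D. s \<le> t \<and> {s..t} \<subseteq> {a..b}) \<and>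
        disjoint_family_on (\<lambda>(s, t). {s<..<t}) D \<and> (\<Sum>(s, t)\<in>D. t - s) < \<delta>
        \<longrightarrow> (\<Sum>(s, t)\<in>D. \<bar>f t - f s\<bar>) < \<epsilon> / 2"
      using ac[unfolded abs_cont_on_def, THEN spec, THEN mp, OF half_gt_zero[OF \<open>\<epsilon> > 0\<close>]] by (elim exE conjE)
    obtain U where U: "open U" "N \<subseteq> U" "U \<in> lmeasurable" "measure lebesgue U < \<delta>"
      using negligible_outer_open[OF N \<open>\<delta> > 0\<close>] by metis
    (* The summand 1 keeps the denominator positive when a = b. *)
    define \<eta> where "\<eta> = \<epsilon> / (2 * (b - a + 1))"
    have "\<eta> > 0" "\<eta> * (b - a) \<le> \<epsilon> / 2"
      using \<open>\<epsilon> > 0\<close> \<open>a \<le> b\<close> by (auto simp: \<eta>_def field_simps)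
    have "\<exists>d>0. \<forall>u v. u \<le> t \<and> t \<le> v \<and> u \<in> ball t d \<and> v \<in> ball t d \<and> u \<in> {a..b} \<and> v \<in> {a..b}
            \<longrightarrow> \<bar>(v - u) * g t - (f v - f u)\<bar> \<le> \<eta> * (v - u)" if "t \<in> {a..b} - N" for t
      using has_vector_derivative_straddle[OF der[OF that] \<open>\<eta> > 0\<close>] by metis
    then obtain d where d: "\<And>t. t \<in> {a..b} - N \<Longrightarrow> d t > 0"
      "\<And>t u v. \<lbrakk>t \<in> {a..b} - N; u \<le> t; t \<le> v; u \<in> ball t (d t); v \<in> ball t (d t); u \<in> {a..b}; v \<in> {a..b}\<rbrakk>
            \<Longrightarrow> \<bar>(v - u) * g t - (f v - f u)\<bar> \<le> \<eta> * (v - u)"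
      by metis
    (* Tags outside {a..b} never occur, but a gauge is defined everywhere. *)
    define \<gamma> where "\<gamma> t = (if t \<in> N then U else if t \<in> {a..b} then ball t (d t) else UNIV)" for t
    show "\<exists>\<gamma>. gauge \<gamma> \<and> (\<forall>p. p tagged_division_of {a..b} \<and> \<gamma> fine p \<longrightarrow>
        norm ((\<Sum>(x, K)\<in>p. measure lborel K *\<^sub>R g0 x) - (f b - f a)) < \<epsilon>)"
    proof (intro exI[of _ \<gamma>] conjI allI impI)
      show "gauge \<gamma>"
        using U d(1) by (auto simp: gauge_def \<gamma>_def)
    next
      fix p assume "p tagged_division_of {a..b} \<and> \<gamma> fine p"
      then have p: "p tagged_division_of {a..b}" and fine: "\<gamma> fine p" by auto
      have fin: "finite p" using p by blast
      have interval: "\<exists>u v. K = {u..v} \<and> u \<le> x \<and> x \<le> v \<and> {u..v} \<subseteq> {a..b} \<and> Inf K = u \<and> Sup K = v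
                        \<and> measure lborel K = v - u"
        if "(x, K) \<in> p" for x K
      proof -
        from tagged_division_ofD(4)[OF p that] obtain u v where "K = {u..v}" by auto
        then show ?thesis
          using tagged_division_ofD(2,3)[OF p that] by (auto simp: content_real)
      qed
      define q where "q = {z \<in> p. fst z \<in> N}"
      define r where "r = {z \<in> p. fst z \<notin> N}"
      have pqr: "p = r \<union> q" "r \<inter> q = {}" "finite r" "finite q"
        using fin by (auto simp: q_def r_def)
      define err where "err = (\<lambda>(x, K). measure lborel K * g0 x - (f (Sup K) - f (Inf K)))"
      have "(\<Sum>(x, K)\<in>p. measure lborel K *\<^sub>R g0 x) - (f b - f a) = (\<Sum>z\<in>p. err z)"
        using additive_tagged_division_1[OF \<open>a \<le> b\<close> p, of f, symmetric]
        by (simp add: err_def case_prod_unfold sum_subtractf)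
      also have "\<dots> = (\<Sum>z\<in>r. err z) + (\<Sum>z\<in>q. err z)"
        using pqr by (simp add: sum.union_disjoint)
      finally have "(\<Sum>(x, K)\<in>p. measure lborel K *\<^sub>R g0 x) - (f b - f a)
          = (\<Sum>z\<in>r. err z) + (\<Sum>z\<in>q. err z)" .
      then have "norm ((\<Sum>(x, K)\<in>p. measure lborel K *\<^sub>R g0 x) - (f b - f a))
          \<le> (\<Sum>z\<in>r. \<bar>err z\<bar>) + (\<Sum>z\<in>q. \<bar>err z\<bar>)"
        using sum_abs[of err r] sum_abs[of err q] unfolding real_norm_def by linarith
      moreover have "(\<Sum>z\<in>r. \<bar>err z\<bar>) \<le> \<epsilon> / 2"
      proof -
        have "\<bar>err z\<bar> \<le> \<eta> * (Sup (snd z) - Inf (snd z))" if "z \<in> r" for z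
        proof -
          obtain x K where z: "z = (x, K)" "(x, K) \<in> p" "x \<notin> N"
            using \<open>z \<in> r\<close> by (cases z) (auto simp: r_def)
          obtain u v where uv: "K = {u..v}" "u \<le> x" "x \<le> v" "{u..v} \<subseteq> {a..b}" "Inf K = u" "Sup K = v"
            "measure lborel K = v - u"
            using interval[OF z(2)] by blast
          have "x \<in> {a..b}" using uv by auto
          then have "K \<subseteq> ball x (d x)"
            using fineD[OF fine z(2)] z(3) by (simp add: \<gamma>_def)
          then have "\<bar>(v - u) * g x - (f v - f u)\<bar> \<le> \<eta> * (v - u)"
            using uv z \<open>x \<in> {a..b}\<close> by (intro d(2) subsetD[OF \<open>K \<subseteq> ball x (d x)\<close>]) auto
          then show ?thesis
            using uv z by (simp add: err_def g0_def)
        qed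
        then have "(\<Sum>z\<in>r. \<bar>err z\<bar>) \<le> (\<Sum>z\<in>r. \<eta> * (Sup (snd z) - Inf (snd z)))"
          by (rule sum_mono)
        also have "\<dots> \<le> (\<Sum>z\<in>p. \<eta> * (Sup (snd z) - Inf (snd z)))"
        proof (rule sum_mono2[OF fin])
          show "r \<subseteq> p" by (auto simp: r_def)
          show "0 \<le> \<eta> * (Sup (snd z) - Inf (snd z))" if "z \<in> p - r" for z
            using interval[of "fst z" "snd z"] that \<open>\<eta> > 0\<close> by auto
        qed
        also have "\<dots> = \<eta> * (b - a)"
          using additive_tagged_division_1[OF \<open>a \<le> b\<close> p, of "\<lambda>x. x"]
          by (simp add: sum_distrib_left[symmetric] case_prod_unfold)
        finally show ?thesis using \<open>\<eta> * (b - a) \<le> \<epsilon> / 2\<close> by simp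
      qed
      moreover have "(\<Sum>z\<in>q. \<bar>err z\<bar>) < \<epsilon> / 2"
      proof -
        have "(\<Sum>z\<in>q. \<bar>err z\<bar>) = (\<Sum>(x, K)\<in>q. \<bar>f (Sup K) - f (Inf K)\<bar>)"
          by (intro sum.cong) (auto simp: q_def err_def g0_def)
        also have "\<dots> < \<epsilon> / 2"
        proof (rule abs_cont_on_partial_division_bound[OF \<delta> _ U(3,4)])
          show "q tagged_partial_division_of {a..b}"
            by (rule tagged_partial_division_subset[of p]) (use p in \<open>auto simp: tagged_division_of_def q_def\<close>)
          show "K \<subseteq> U" if "(x, K) \<in> q" for x K
            using that fineD[OF fine, of x K] by (simp add: q_def \<gamma>_def)
        qed
        finally show ?thesis .
      qed
      ultimately show "norm ((\<Sum>(x, K)\<in>p. measure lborel K *\<^sub>R g0 x) - (f b - f a)) < \<epsilon>"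
        by simp
    qed
  qed
  then show ?thesis
    by (rule has_integral_spike[OF N, rotated]) (simp add: g0_def)
qed

lemma abs_cont_on_bounded_derivative_imp_lipschitz:
  assumes ac: "abs_cont_on {a..b} f" and N: "negligible N" and "C \<ge> 0"
    and der: "\<And>t. t \<in> {a..b} - N \<Longrightarrow> (f has_real_derivative g t) (at t within {a..b}) \<and> \<bar>g t\<bar> \<le> C"
  shows "C-lipschitz_on {a..b} f"
proof -
  have le: "\<bar>f t - f s\<bar> \<le> C * (t - s)" if st: "s \<in> {a..b}" "t \<in> {a..b}" "s \<le> t" for s t
  proof -
    have sub: "{s..t} \<subseteq> {a..b}" using st by auto
    have "(g has_integral (f t - f s)) {s..t}"
    proof (rule abs_cont_on_imp_has_integral_derivative[OF \<open>s \<le> t\<close> abs_cont_on_subset[OF ac sub] N])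
      fix z assume "z \<in> {s..t} - N"
      then show "(f has_vector_derivative g z) (at z within {s..t})"
        using der[of z] sub
        by (auto simp: has_real_derivative_iff_has_vector_derivative
            intro: has_vector_derivative_within_subset)
    qed
    then have "((\<lambda>z. if z \<in> N then 0 else g z) has_integral (f t - f s)) {s..t}"
      by (rule has_integral_spike[OF N, rotated]) simp
    then have "norm (f t - f s) \<le> C * measure lborel (cbox s t)"
      using der sub \<open>C \<ge> 0\<close> by (intro has_integral_bound) (auto simp: subset_iff)
    then show ?thesis
      using \<open>s \<le> t\<close> by simp
  qed
  show ?thesis
  proof (rule lipschitz_onI)
    fix s t assume "s \<in> {a..b}" "t \<in> {a..b}"
    then show "dist (f s) (f t) \<le> C * dist s t"
      using le[of s t] le[of t s] by (cases "s \<le> t") (auto simp: dist_real_def)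
  qed fact
qed

section \<open>Bending a heading\<close>

lemma norm_cis_minus_1_le: "norm (cis h - 1) \<le> \<bar>h\<bar>"
  using Taylor_exp[of "\<i> * complex_of_real h" 0]
  by (simp add: cis_conv_exp norm_mult)

lemma norm_cis_diff_le: "norm (cis \<alpha> - cis \<beta>) \<le> \<bar>\<alpha> - \<beta>\<bar>"
proof -
  have "cis \<alpha> - cis \<beta> = cis \<beta> * (cis (\<alpha> - \<beta>) - 1)"
    by (simp add: right_diff_distrib cis_mult)
  then show ?thesis
    using norm_cis_minus_1_le[of "\<alpha> - \<beta>"] by (simp add: norm_mult)
qed

lemma norm_cis_Taylor_1_le: "norm (cis (\<alpha> + h) - cis \<alpha> - h *\<^sub>R (\<i> * cis \<alpha>)) \<le> h\<^sup>2"
proof -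
  have "norm (cis h - (1 + \<i> * h)) \<le> h\<^sup>2"
    using Taylor_exp[of "\<i> * complex_of_real h" 1]
    by (simp add: cis_conv_exp norm_mult power2_eq_square)
  moreover have "cis (\<alpha> + h) - cis \<alpha> - h *\<^sub>R (\<i> * cis \<alpha>) = cis \<alpha> * (cis h - (1 + \<i> * h))"
    by (simp add: cis_mult[symmetric] scaleR_conv_of_real algebra_simps)
  ultimately show ?thesis
    by (simp add: norm_mult)
qed

text \<open>
  An admissible variation of the heading \<open>\<theta>\<close>. Identify the plane with the complex numbers, so that
  \<open>cis (\<theta> s)\<close> is the unit tangent and \<open>\<i> * cis (\<theta> s)\<close> the unit normal.
  The factor \<open>s * (T - s)\<close> keeps both end headings; the factor
  \<open>v \<bullet> (\<i> * cis (\<theta> s))\<close>, the normal component of a fixed direction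
  \<open>v\<close>, turns the curve towards \<open>v\<close> everywhere, so that to first order the endpoint moves with
  a nonnegative component along \<open>v\<close>.
\<close>

definition bend :: "real \<Rightarrow> (real \<Rightarrow> real) \<Rightarrow> complex \<Rightarrow> real \<Rightarrow> real" where
  "bend T \<theta> v s = s * (T - s) * (v \<bullet> (\<i> * cis (\<theta> s)))"

lemma bend_zero [simp]: "bend T \<theta> 0 s = 0" "bend T \<theta> v 0 = 0" "bend T \<theta> v T = 0"
  by (simp_all add: bend_def)

lemma bend_add: "bend T \<theta> (v + w) s = bend T \<theta> v s + bend T \<theta> w s"
  and bend_diff: "bend T \<theta> (v - w) s = bend T \<theta> v s - bend T \<theta> w s"
  and bend_scaleR: "bend T \<theta> (c *\<^sub>R v) s = c * bend T \<theta> v s"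
  by (simp_all add: bend_def inner_add_left inner_diff_left algebra_simps)

lemma abs_inner_icis_le: "\<bar>v \<bullet> (\<i> * cis \<alpha>)\<bar> \<le> norm v" "\<bar>v \<bullet> cis \<alpha>\<bar> \<le> norm v"
  using Cauchy_Schwarz_ineq2[of v "\<i> * cis \<alpha>"] Cauchy_Schwarz_ineq2[of v "cis \<alpha>"]
  by (simp_all add: norm_mult)

lemma bump_bounds:
  fixes s T :: real
  assumes "s \<in> {0..T}"
  shows "0 \<le> s * (T - s)" "s * (T - s) \<le> T\<^sup>2"
  using assms mult_mono[of s T "T - s" T] by (auto simp: power2_eq_square)

lemma abs_bend_le:
  assumes "s \<in> {0..T}"
  shows "\<bar>bend T \<theta> v s\<bar> \<le> T\<^sup>2 * norm v"
  unfolding bend_def abs_mult[of "s * (T - s)"]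
  using bump_bounds[OF assms] abs_inner_icis_le(1)[of v] by (intro mult_mono) auto

lemma continuous_on_bend [continuous_intros]:
  "continuous_on S \<theta> \<Longrightarrow> continuous_on S (bend T \<theta> v)"
  unfolding bend_def by (intro continuous_intros)

lemma inner_icis_eq: "v \<bullet> (\<i> * cis \<alpha>) = Im v * cos \<alpha> - Re v * sin \<alpha>"
  by (simp add: inner_complex_def)

text \<open>
  The curvature of the bent curve, that is, the derivative of \<open>\<theta> s + bend T \<theta> v s\<close>
  when \<open>\<theta>\<close> has derivative \<open>u s\<close>.
\<close>

definition bent_control where
  "bent_control T \<theta> u v s =
     u s + (T - 2 * s) * (v \<bullet> (\<i> * cis (\<theta> s))) - s * (T - s) * (v \<bullet> cis (\<theta> s)) * u s"

lemma has_real_derivative_bent_heading: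
  assumes "(\<theta> has_real_derivative u s) (at s within S)"
  shows "((\<lambda>s. \<theta> s + bend T \<theta> v s) has_real_derivative bent_control T \<theta> u v s) (at s within S)"
  unfolding bend_def inner_icis_eq bent_control_def
  by (rule derivative_eq_intros refl assms)+ (simp add: inner_complex_def algebra_simps)

text \<open>
  The curvature grows at most linearly in the size of the bend, so a small bend uses up only part of any given curvature
  slack.
\<close>

lemma abs_bent_control_le:
  assumes "s \<in> {0..T}" "\<bar>u s\<bar> \<le> b"
  shows "\<bar>bent_control T \<theta> u v s\<bar> \<le> b + (T + T\<^sup>2 * b) * norm v"
proof -
  have "\<bar>(T - 2 * s) * (v \<bullet> (\<i> * cis (\<theta> s)))\<bar> \<le> T * norm v"
    unfolding abs_mult using assms abs_inner_icis_le(1)[of v] by (intro mult_mono) auto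
  moreover have "\<bar>s * (T - s) * (v \<bullet> cis (\<theta> s)) * u s\<bar> \<le> T\<^sup>2 * norm v * b"
    unfolding abs_mult[of "_ * (v \<bullet> _)"] abs_mult[of "s * (T - s)"]
    using assms bump_bounds[OF assms(1)] abs_inner_icis_le(2)[of v] by (intro mult_mono) auto
  ultimately show ?thesis
    using assms(2) unfolding bent_control_def by (simp add: algebra_simps)
qed

lemma lipschitz_on_bent_heading:
  assumes lip: "b-lipschitz_on {0..T} \<theta>" and "T \<ge> 0"
  shows "(b + (T + T\<^sup>2 * b) * norm v)-lipschitz_on {0..T} (\<lambda>s. \<theta> s + bend T \<theta> v s)"
proof (rule lipschitz_onI)
  have "b \<ge> 0" using lip by (rule lipschitz_on_nonneg)
  then show "0 \<le> b + (T + T\<^sup>2 * b) * norm v" using \<open>T \<ge> 0\<close> by simp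
  fix s t assume st: "s \<in> {0..T}" "t \<in> {0..T}"
  let ?n = "\<lambda>s. v \<bullet> (\<i> * cis (\<theta> s))"
  have \<theta>: "\<bar>\<theta> s - \<theta> t\<bar> \<le> b * \<bar>s - t\<bar>"
    using lipschitz_onD[OF lip st] by (simp add: dist_real_def)
  have "\<bar>?n s - ?n t\<bar> = \<bar>v \<bullet> (\<i> * (cis (\<theta> s) - cis (\<theta> t)))\<bar>"
    by (simp add: inner_diff_right right_diff_distrib)
  also have "\<dots> \<le> norm v * norm (cis (\<theta> s) - cis (\<theta> t))"
    using Cauchy_Schwarz_ineq2[of v "\<i> * (cis (\<theta> s) - cis (\<theta> t))"] by (simp add: norm_mult)
  also have "\<dots> \<le> norm v * (b * \<bar>s - t\<bar>)"
    using norm_cis_diff_le[of "\<theta> s" "\<theta> t"] \<theta> by (intro mult_left_mono) auto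
  finally have n: "\<bar>?n s - ?n t\<bar> \<le> norm v * (b * \<bar>s - t\<bar>)" .
  have "bend T \<theta> v s - bend T \<theta> v t
      = s * (T - s) * (?n s - ?n t) + (s - t) * (T - s - t) * ?n t"
    by (simp add: bend_def algebra_simps)
  moreover have "\<bar>s * (T - s) * (?n s - ?n t)\<bar> \<le> T\<^sup>2 * (norm v * (b * \<bar>s - t\<bar>))"
    unfolding abs_mult[of "s * (T - s)"]
    using n bump_bounds[OF st(1)] by (intro mult_mono) auto
  moreover have "\<bar>(s - t) * (T - s - t) * ?n t\<bar> \<le> \<bar>s - t\<bar> * T * norm v"
    unfolding abs_mult using st abs_inner_icis_le(1)[of v] by (intro mult_mono) auto
  ultimately have "\<bar>bend T \<theta> v s - bend T \<theta> v t\<bar>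
      \<le> T\<^sup>2 * (norm v * (b * \<bar>s - t\<bar>)) + \<bar>s - t\<bar> * T * norm v"
    by linarith
  then have "\<bar>(\<theta> s + bend T \<theta> v s) - (\<theta> t + bend T \<theta> v t)\<bar>
      \<le> b * \<bar>s - t\<bar> + (T\<^sup>2 * (norm v * (b * \<bar>s - t\<bar>)) + \<bar>s - t\<bar> * T * norm v)"
    using \<theta> by linarith
  then show "dist (\<theta> s + bend T \<theta> v s) (\<theta> t + bend T \<theta> v t) \<le> (b + (T + T\<^sup>2 * b) * norm v) * dist s t"
    by (simp add: dist_real_def algebra_simps)
qed

lemma borel_measurable_bent_control:
  assumes "u \<in> borel_measurable (lebesgue_on {0..T})" "continuous_on {0..T} \<theta>"
  shows "bent_control T \<theta> u v \<in> borel_measurable (lebesgue_on {0..T})"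
proof -
  have "(\<lambda>s. (T - 2 * s) * (v \<bullet> (\<i> * cis (\<theta> s)))) \<in> borel_measurable (lebesgue_on {0..T})"
    "(\<lambda>s. s * (T - s) * (v \<bullet> cis (\<theta> s))) \<in> borel_measurable (lebesgue_on {0..T})"
    by (intro continuous_imp_measurable_on_sets_lebesgue continuous_intros assms; simp)+
  from borel_measurable_diff[OF borel_measurable_add[OF assms(1) this(1)]
      borel_measurable_times[OF this(2) assms(1)]]
  show ?thesis
    by (simp add: bent_control_def[abs_def])
qed

section \<open>The displacement of bent curves\<close>

definition bent_displacement :: "real \<Rightarrow> (real \<Rightarrow> real) \<Rightarrow> complex \<Rightarrow> complex" where
  "bent_displacement T \<theta> v = integral {0..T} (\<lambda>s. cis (\<theta> s + bend T \<theta> v s))"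

text \<open>
  The derivative of \<open>bent_displacement\<close> at \<open>0\<close>: rotating the unit tangent moves it along the
  unit normal.
\<close>

definition bending_derivative :: "real \<Rightarrow> (real \<Rightarrow> real) \<Rightarrow> complex \<Rightarrow> complex" where
  "bending_derivative T \<theta> v = integral {0..T} (\<lambda>s. bend T \<theta> v s *\<^sub>R (\<i> * cis (\<theta> s)))"

lemma bounded_linear_bending_derivative:
  assumes "continuous_on {0..T} \<theta>"
  shows "bounded_linear (bending_derivative T \<theta>)"
proof -
  have int: "(\<lambda>s. bend T \<theta> v s *\<^sub>R (\<i> * cis (\<theta> s))) integrable_on {0..T}" for v
    by (intro integrable_continuous_real continuous_intros assms)
  have "linear (bending_derivative T \<theta>)"
  proof (rule linearI)
    show "bending_derivative T \<theta> (v + w) = bending_derivative T \<theta> v + bending_derivative T \<theta> w" for v w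
      unfolding bending_derivative_def bend_add scaleR_add_left by (rule integral_add[OF int int])
    show "bending_derivative T \<theta> (c *\<^sub>R v) = c *\<^sub>R bending_derivative T \<theta> v" for c v
      unfolding bending_derivative_def bend_scaleR scaleR_scaleR[symmetric] by (rule integral_cmul)
  qed
  then show ?thesis by (simp add: linear_conv_bounded_linear)
qed

lemma continuous_on_bent_displacement:
  assumes "T > 0" "continuous_on {0..T} \<theta>"
  shows "continuous_on S (bent_displacement T \<theta>)"
proof (rule lipschitz_on_continuous_on[OF lipschitz_onI])
  fix v w
  have int: "(\<lambda>s. cis (\<theta> s + bend T \<theta> v s)) integrable_on {0..T}" for v
    by (intro integrable_continuous_real continuous_intros assms)
  have "bent_displacement T \<theta> v - bent_displacement T \<theta> w
      = integral {0..T} (\<lambda>s. cis (\<theta> s + bend T \<theta> v s) - cis (\<theta> s + bend T \<theta> w s))"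
    unfolding bent_displacement_def by (rule integral_diff[symmetric, OF int int])
  also have "norm \<dots> \<le> T\<^sup>2 * norm (v - w) * (T - 0)"
  proof (rule integral_bound)
    fix s assume "s \<in> {0..T}"
    have "norm (cis (\<theta> s + bend T \<theta> v s) - cis (\<theta> s + bend T \<theta> w s)) \<le> \<bar>bend T \<theta> (v - w) s\<bar>"
      using norm_cis_diff_le[of "\<theta> s + bend T \<theta> v s" "\<theta> s + bend T \<theta> w s"] by (simp add: bend_diff)
    also have "\<dots> \<le> T\<^sup>2 * norm (v - w)" by (rule abs_bend_le) fact
    finally show "norm (cis (\<theta> s + bend T \<theta> v s) - cis (\<theta> s + bend T \<theta> w s)) \<le> T\<^sup>2 * norm (v - w)" .
  qed (use assms in \<open>auto intro!: continuous_intros\<close>)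
  finally show "dist (bent_displacement T \<theta> v) (bent_displacement T \<theta> w) \<le> T ^ 3 * dist v w"
    by (simp add: dist_norm power2_eq_square power3_eq_cube algebra_simps)
qed (use assms in simp)

text \<open>
  The bend is at most \<open>T\<^sup>2 * norm v\<close>, and linearizing \<open>cis\<close> costs the square of the
  angle. Integrating over \<open>{0..T}\<close> gives the error \<open>T ^ 5 * (norm v)\<^sup>2\<close>.
\<close>

lemma has_derivative_bent_displacement_0:
  assumes "T > 0" "continuous_on {0..T} \<theta>"
  shows "(bent_displacement T \<theta> has_derivative bending_derivative T \<theta>) (at 0)"
  unfolding has_derivative_at_alt
proof (intro conjI allI impI)
  show "bounded_linear (bending_derivative T \<theta>)"
    by (rule bounded_linear_bending_derivative) fact
next
  fix e :: real assume "e > 0"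
  have quadratic: "norm (bent_displacement T \<theta> v - bent_displacement T \<theta> 0 - bending_derivative T \<theta> v)
      \<le> T ^ 5 * (norm v)\<^sup>2" for v
  proof -
    have "bent_displacement T \<theta> v - bent_displacement T \<theta> 0 - bending_derivative T \<theta> v
      = integral {0..T} (\<lambda>s. cis (\<theta> s + bend T \<theta> v s) - cis (\<theta> s) - bend T \<theta> v s *\<^sub>R (\<i> * cis (\<theta> s)))"
      unfolding bent_displacement_def bending_derivative_def bend_zero add_0_right
      by (subst integral_diff integral_diff, (intro integrable_continuous_real continuous_intros assms)+)+ simp
    also have "norm \<dots> \<le> (T\<^sup>2 * norm v)\<^sup>2 * (T - 0)"
    proof (rule integral_bound)
      fix s assume s: "s \<in> {0..T}"
      have "(bend T \<theta> v s)\<^sup>2 \<le> (T\<^sup>2 * norm v)\<^sup>2"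
        using power_mono[OF abs_bend_le[OF s, of \<theta> v], of 2] by simp
      then show "norm (cis (\<theta> s + bend T \<theta> v s) - cis (\<theta> s) - bend T \<theta> v s *\<^sub>R (\<i> * cis (\<theta> s)))
          \<le> (T\<^sup>2 * norm v)\<^sup>2"
        using norm_cis_Taylor_1_le order_trans by blast
    qed (use assms in \<open>auto intro!: continuous_intros\<close>)
    finally show ?thesis
      by (simp add: power_mult_distrib power_add[symmetric] eval_nat_numeral algebra_simps)
  qed
  show "\<exists>d>0. \<forall>v. norm (v - 0) < d \<longrightarrow>
      norm (bent_displacement T \<theta> v - bent_displacement T \<theta> 0 - bending_derivative T \<theta> (v - 0)) \<le> e * norm (v - 0)"
  proof (intro exI[of _ "e / T ^ 5"] conjI allI impI)
    show "0 < e / T ^ 5" using \<open>e > 0\<close> assms by simp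
  next
    fix v :: complex assume "norm (v - 0) < e / T ^ 5"
    then have "T ^ 5 * norm v \<le> e" using assms by (simp add: field_simps)
    then have "T ^ 5 * norm v * norm v \<le> e * norm v" by (rule mult_right_mono) simp
    then show "norm (bent_displacement T \<theta> v - bent_displacement T \<theta> 0 - bending_derivative T \<theta> (v - 0))
        \<le> e * norm (v - 0)"
      using quadratic[of v] by (simp add: power2_eq_square mult.assoc)
  qed
qed

text \<open>
  The reason for the choice of \<open>bend\<close>: the derivative of the displacement is a weighted Gram operator of
  the normals, so its quadratic form is the integral of a square with a weight that is positive inside
  \<open>{0..T}\<close>.
\<close>

lemma inner_bending_derivative:
  assumes "continuous_on {0..T} \<theta>"
  shows "v \<bullet> bending_derivative T \<theta> v = integral {0..T} (\<lambda>s. s * (T - s) * (v \<bullet> (\<i> * cis (\<theta> s)))\<^sup>2)"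
proof -
  have "(\<lambda>s. bend T \<theta> v s *\<^sub>R (\<i> * cis (\<theta> s))) integrable_on {0..T}"
    by (intro integrable_continuous_real continuous_intros assms)
  from integral_linear[OF this bounded_linear_inner_right[of v]]
  show ?thesis
    by (simp add: bending_derivative_def o_def bend_def power2_eq_square mult.assoc)
qed

text \<open>
  If a fixed direction \<open>v\<close> is orthogonal to all normals, then it is parallel to all tangents; by continuity
  the tangent cannot switch between the two orientations, so the curve is a segment and its displacement is as long as
  the curve.
\<close>

lemma straight_if_orthogonal_to_normals:
  assumes T: "T > 0" and cont: "continuous_on {0..T} \<theta>" and "v \<noteq> 0"
    and perp: "\<And>s. s \<in> {0..T} \<Longrightarrow> v \<bullet> (\<i> * cis (\<theta> s)) = 0"
  shows "norm (integral {0..T} (\<lambda>s. cis (\<theta> s))) \<ge> T"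
proof -
  let ?c = "\<lambda>s. v \<bullet> cis (\<theta> s)"
  have sq: "\<bar>?c s\<bar> = norm v" if "s \<in> {0..T}" for s
  proof -
    have "(v \<bullet> w)\<^sup>2 + (v \<bullet> (\<i> * w))\<^sup>2 = (norm v)\<^sup>2 * (norm w)\<^sup>2" for w
      unfolding cmod_power2 by (simp add: inner_complex_def power2_eq_square algebra_simps)
    from this[of "cis (\<theta> s)"]
    have "(?c s)\<^sup>2 = (norm v)\<^sup>2"
      using perp[OF that] by simp
    then show ?thesis
      by (metis abs_norm_cancel power2_eq_iff abs_minus_cancel)
  qed
  have "?c constant_on {0..T}"
  proof (rule continuous_finite_range_constant)
    show "finite (?c ` {0..T})"
      by (rule finite_subset[of _ "{norm v, - norm v}"]) (use sq in \<open>fastforce simp: abs_if split: if_splits\<close>)+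
  qed (auto intro!: continuous_intros cont)
  then obtain k where k: "\<And>s. s \<in> {0..T} \<Longrightarrow> ?c s = k"
    by (auto simp: constant_on_def)
  have "\<bar>k\<bar> = norm v" using sq[of 0] k[of 0] T by simp
  have "v \<bullet> integral {0..T} (\<lambda>s. cis (\<theta> s)) = integral {0..T} ?c"
    using integral_linear[OF integrable_continuous_real[OF continuous_on_cis[OF cont]] bounded_linear_inner_right[of v]]
    by (simp add: o_def)
  also have "\<dots> = integral {0..T} (\<lambda>s. k)"
    by (rule integral_cong) (rule k)
  finally have "T * norm v = \<bar>v \<bullet> integral {0..T} (\<lambda>s. cis (\<theta> s))\<bar>"
    using T \<open>\<bar>k\<bar> = norm v\<close> by (simp add: abs_mult)
  also have "\<dots> \<le> norm v * norm (integral {0..T} (\<lambda>s. cis (\<theta> s)))"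
    by (rule Cauchy_Schwarz_ineq2)
  finally show ?thesis
    using \<open>v \<noteq> 0\<close> by simp
qed

text \<open>
  For a curve that is longer than its chord the derivative of the displacement is injective, hence invertible on the
  plane, so the displacement map is open at \<open>0\<close>.
\<close>

lemma bent_displacement_interior:
  assumes T: "T > 0" and cont: "continuous_on {0..T} \<theta>"
    and not_straight: "norm (integral {0..T} (\<lambda>s. cis (\<theta> s))) < T"
    and "r > 0"
  shows "integral {0..T} (\<lambda>s. cis (\<theta> s)) \<in> interior (bent_displacement T \<theta> ` ball 0 r)"
proof -
  note bl = bounded_linear_bending_derivative[OF cont]
  then have lin: "linear (bending_derivative T \<theta>)" by (simp add: linear_conv_bounded_linear)
  have inj: "inj (bending_derivative T \<theta>)"
    unfolding linear_injective_0[OF lin]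
  proof (intro allI impI, rule ccontr)
    fix v assume "bending_derivative T \<theta> v = 0" "v \<noteq> 0"
    let ?f = "\<lambda>s. s * (T - s) * (v \<bullet> (\<i> * cis (\<theta> s)))\<^sup>2"
    have "integral {0..T} ?f = 0"
      using inner_bending_derivative[OF cont, of v] \<open>bending_derivative T \<theta> v = 0\<close> by simp
    then have zero: "?f s = 0" if "s \<in> {0..T}" for s
    proof -
      have "integral {0..T} ?f = 0 \<longleftrightarrow> (\<forall>s\<in>{0..T}. ?f s = 0)"
      proof (rule integral_eq_0_iff[OF _ T])
        show "continuous_on {0..T} ?f" by (intro continuous_intros cont)
        show "?f s \<ge> 0" if "s \<in> {0..T}" for s
          by (rule mult_nonneg_nonneg[OF bump_bounds(1)[OF that]]) simp
      qed
      then show ?thesis using \<open>integral {0..T} ?f = 0\<close> that by blast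
    qed
    (* The weight s * (T - s) vanishes at both ends, which are reached by continuity. *)
    have "v \<bullet> (\<i> * cis (\<theta> s)) = 0" if "s \<in> {0..T}" for s
    proof (rule continuous_constant_on_closure[of "{0<..<T}" "\<lambda>s. v \<bullet> (\<i> * cis (\<theta> s))"])
      show "continuous_on (closure {0<..<T}) (\<lambda>s. v \<bullet> (\<i> * cis (\<theta> s)))"
        using T by (auto intro!: continuous_intros cont)
      show "v \<bullet> (\<i> * cis (\<theta> s)) = 0" if "s \<in> {0<..<T}" for s
        using zero[of s] that by auto
      show "s \<in> closure {0<..<T}" using T that by auto
    qed
    then show False
      using straight_if_orthogonal_to_normals[OF T cont \<open>v \<noteq> 0\<close>] not_straight by fastforce
  qed
  obtain g where g: "linear g" "\<And>x. bending_derivative T \<theta> (g x) = x"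
    using linear_injective_isomorphism[OF lin inj] by blast
  have "bent_displacement T \<theta> 0 \<in> interior (bent_displacement T \<theta> ` ball 0 r)"
  proof (rule sussmann_open_mapping[of UNIV])
    show "(bent_displacement T \<theta> has_derivative bending_derivative T \<theta>) (at 0)"
      by (rule has_derivative_bent_displacement_0[OF T cont])
    show "bounded_linear g" "bending_derivative T \<theta> \<circ> g = id"
      using g by (auto simp: linear_conv_bounded_linear)
  qed (use \<open>r > 0\<close> in \<open>auto intro: continuous_on_bent_displacement[OF T cont]\<close>)
  then show ?thesis
    by (simp add: bent_displacement_def)
qed

section \<open>Trajectories and their headings\<close>

lemma has_integral_complex_iff:
  "(f has_integral I) A \<longleftrightarrow>
    ((\<lambda>t. Re (f t)) has_integral Re I) A \<and> ((\<lambda>t. Im (f t)) has_integral Im I) A"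
  by (subst has_integral_componentwise_iff) (simp add: Basis_complex_def)

text \<open>
  Everything that the shortening argument uses about an admissible trajectory concerns its heading: the positions only
  enter through the total displacement, the integral of the unit tangent.
\<close>

lemma dubins_trajectory_heading:
  assumes con: "dubins_constraints (x0, y0, \<theta>0) (xf, yf, \<theta>f) T b x y \<theta> u" and "T > 0" "b \<ge> 0"
  obtains N where "negligible N"
    "\<And>t. t \<in> {0..T} - N \<Longrightarrow> (\<theta> has_real_derivative u t) (at t within {0..T})"
    "\<And>t. t \<in> {0..T} - N \<Longrightarrow> \<bar>u t\<bar> \<le> b"
    "b-lipschitz_on {0..T} \<theta>"
    "integral {0..T} (\<lambda>t. cis (\<theta> t)) = Complex (xf - x0) (yf - y0)"
proof -
  have ac: "abs_cont_on {0..T} x" "abs_cont_on {0..T} y" "abs_cont_on {0..T} \<theta>"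
    and ends: "x 0 = x0" "y 0 = y0" "x T = xf" "y T = yf"
    and ae: "AE t in lebesgue_on {0..T}.
           (x has_real_derivative cos (\<theta> t)) (at t within {0..T}) \<and>
           (y has_real_derivative sin (\<theta> t)) (at t within {0..T}) \<and>
           (\<theta> has_real_derivative u t) (at t within {0..T})"
      "AE t in lebesgue_on {0..T}. \<bar>u t\<bar> \<le> b"
    using con by (auto simp: dubins_constraints_def)
  obtain N where N: "negligible N" and der: "\<And>t. t \<in> {0..T} - N \<Longrightarrow>
           (x has_real_derivative cos (\<theta> t)) (at t within {0..T}) \<and>
           (y has_real_derivative sin (\<theta> t)) (at t within {0..T}) \<and>
           (\<theta> has_real_derivative u t) (at t within {0..T}) \<and> \<bar>u t\<bar> \<le> b"
    using AE_conjI[OF ae] by (subst (asm) AE_lebesgue_on_iff_negligible) auto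
  have lip: "b-lipschitz_on {0..T} \<theta>"
    by (rule abs_cont_on_bounded_derivative_imp_lipschitz[OF ac(3) N \<open>b \<ge> 0\<close>]) (use der in blast)
  have "((\<lambda>t. cos (\<theta> t)) has_integral (x T - x 0)) {0..T}"
    by (rule abs_cont_on_imp_has_integral_derivative[OF _ ac(1) N])
       (use der \<open>T > 0\<close> in \<open>auto simp: has_real_derivative_iff_has_vector_derivative\<close>)
  moreover have "((\<lambda>t. sin (\<theta> t)) has_integral (y T - y 0)) {0..T}"
    by (rule abs_cont_on_imp_has_integral_derivative[OF _ ac(2) N])
       (use der \<open>T > 0\<close> in \<open>auto simp: has_real_derivative_iff_has_vector_derivative\<close>)
  ultimately have "((\<lambda>t. cis (\<theta> t)) has_integral Complex (xf - x0) (yf - y0)) {0..T}"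
    by (simp add: has_integral_complex_iff ends)
  then show ?thesis
    using that[OF N _ _ lip] der by (auto simp: integral_unique)
qed

text \<open>
  Conversely, a Lipschitz heading with the correct total displacement determines a trajectory, by integrating the unit
  tangent.
\<close>

lemma dubins_constraints_of_heading:
  assumes "T > 0" and lip: "C-lipschitz_on {0..T} \<theta>" and N: "negligible N"
    and u: "u \<in> borel_measurable (lebesgue_on {0..T})"
    and der: "\<And>t. t \<in> {0..T} - N \<Longrightarrow> (\<theta> has_real_derivative u t) (at t within {0..T})"
    and bound: "\<And>t. t \<in> {0..T} - N \<Longrightarrow> \<bar>u t\<bar> \<le> a"
    and ends: "[\<theta> 0 = \<theta>0] (rmod (2 * pi))" "[\<theta> T = \<theta>f] (rmod (2 * pi))"
    and disp: "integral {0..T} (\<lambda>t. cis (\<theta> t)) = Complex (xf - x0) (yf - y0)"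
  shows "\<exists>x y. dubins_constraints (x0, y0, \<theta>0) (xf, yf, \<theta>f) T a x y \<theta> u"
proof -
  have cont: "continuous_on {0..T} \<theta>" using lip by (rule lipschitz_on_continuous_on)
  define x where "x t = x0 + integral {0..t} (\<lambda>s. cos (\<theta> s))" for t
  define y where "y t = y0 + integral {0..t} (\<lambda>s. sin (\<theta> s))" for t
  have dx: "(x has_real_derivative cos (\<theta> t)) (at t within {0..T})" if "t \<in> {0..T}" for t
    unfolding x_def using that
    by (auto intro!: derivative_eq_intros integral_has_real_derivative continuous_intros cont)
  have dy: "(y has_real_derivative sin (\<theta> t)) (at t within {0..T})" if "t \<in> {0..T}" for t
    unfolding y_def using that
    by (auto intro!: derivative_eq_intros integral_has_real_derivative continuous_intros cont)
  have ac: "abs_cont_on {0..T} f" if "\<And>t. t \<in> {0..T} \<Longrightarrow> (f has_real_derivative g t) (at t within {0..T})"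
    "\<And>t. \<bar>g t\<bar> \<le> 1" for f g
  proof (rule lipschitz_imp_abs_cont_on[of 1], rule bounded_derivative_imp_lipschitz)
    show "(f has_derivative (*) (g t)) (at t within {0..T})" if "t \<in> {0..T}" for t
      using \<open>t \<in> {0..T} \<Longrightarrow> (f has_real_derivative g t) (at t within {0..T})\<close> that
      by (simp add: has_field_derivative_def)
    show "onorm ((*) (g t)) \<le> 1" for t
      using \<open>\<bar>g t\<bar> \<le> 1\<close> by (intro onorm_le) (auto simp: abs_mult mult_left_le_one_le)
  qed auto
  have "((\<lambda>t. cis (\<theta> t)) has_integral Complex (xf - x0) (yf - y0)) {0..T}"
    using disp cont by (metis continuous_on_cis integrable_continuous_real integrable_integral)
  then have "x T = xf" "y T = yf"
    by (auto simp: x_def y_def has_integral_complex_iff dest!: integral_unique)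
  moreover have "AE t in lebesgue_on {0..T}.
           (x has_real_derivative cos (\<theta> t)) (at t within {0..T}) \<and>
           (y has_real_derivative sin (\<theta> t)) (at t within {0..T}) \<and>
           (\<theta> has_real_derivative u t) (at t within {0..T})"
    using N der dx dy by (subst AE_lebesgue_on_iff_negligible) auto
  moreover have "AE t in lebesgue_on {0..T}. \<bar>u t\<bar> \<le> a"
    using N bound by (subst AE_lebesgue_on_iff_negligible) auto
  ultimately have "dubins_constraints (x0, y0, \<theta>0) (xf, yf, \<theta>f) T a x y \<theta> u"
    using ac[OF dx] ac[OF dy] lipschitz_imp_abs_cont_on[OF lip] u ends
    by (auto simp: dubins_constraints_def Linfty_on_def x_def y_def)
  then show ?thesis by blast
qed

lemma borel_measurable_speed_up:
  fixes w :: "real \<Rightarrow> real"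
  assumes "c > 0" "w \<in> borel_measurable (lebesgue_on {0..T})"
  shows "(\<lambda>t. c * w (c * t)) \<in> borel_measurable (lebesgue_on {0..T / c})"
proof -
  have "(\<lambda>s. if s \<in> {0..T} then w s else 0) \<in> borel_measurable lebesgue"
    using assms(2) by (subst borel_measurable_if) auto
  from borel_measurable_affine[OF this, of c 0] \<open>c > 0\<close>
  have "(\<lambda>t. if c * t \<in> {0..T} then w (c * t) else 0) \<in> borel_measurable lebesgue"
    unfolding real_scaleR_def add_0_left by simp
  moreover have "c * t \<in> {0..T} \<longleftrightarrow> t \<in> {0..T / c}" for t
    using \<open>c > 0\<close> by (auto simp: field_simps zero_le_mult_iff)
  ultimately have "(\<lambda>t. w (c * t)) \<in> borel_measurable (lebesgue_on {0..T / c})"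
    by (intro borel_measurable_if_D) simp
  then show ?thesis by simp
qed

text \<open>
  A heading whose displacement is \<open>c\<close> times the prescribed one yields, run through \<open>c\<close> times
  as fast, a unit speed curve of length \<open>T / c\<close> with the prescribed endpoints. Its curvature is
  multiplied by \<open>c\<close>: geometrically, this is the homothety with ratio \<open>1 / c\<close>.
\<close>

lemma dubins_constraints_speed_up:
  assumes "c > 0" "T > 0" and lip: "C-lipschitz_on {0..T} \<psi>" and N: "negligible N"
    and w: "w \<in> borel_measurable (lebesgue_on {0..T})"
    and der: "\<And>s. s \<in> {0..T} - N \<Longrightarrow> (\<psi> has_real_derivative w s) (at s within {0..T})"
    and bound: "\<And>s. s \<in> {0..T} - N \<Longrightarrow> c * \<bar>w s\<bar> \<le> a"
    and ends: "[\<psi> 0 = \<theta>0] (rmod (2 * pi))" "[\<psi> T = \<theta>f] (rmod (2 * pi))"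
    and disp: "integral {0..T} (\<lambda>s. cis (\<psi> s)) = c *\<^sub>R Complex (xf - x0) (yf - y0)"
  shows "\<exists>x y. dubins_constraints (x0, y0, \<theta>0) (xf, yf, \<theta>f) (T / c) a x y (\<lambda>t. \<psi> (c * t)) (\<lambda>t. c * w (c * t))"
proof (rule dubins_constraints_of_heading)
  have mem: "c * t \<in> {0..T}" if "t \<in> {0..T / c}" for t
    using that \<open>c > 0\<close> by (auto simp: field_simps)
  define M where "M = (\<lambda>s. s / c) ` N"
  show "T / c > 0" using assms(1,2) by simp
  show "negligible M"
    unfolding M_def
    by (rule negligible_differentiable_image_negligible[OF _ N])
       (auto intro: bounded_linear_imp_differentiable_on bounded_linear_divide)
  have off: "c * t \<in> {0..T} - N" if "t \<in> {0..T / c} - M" for t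
    using mem that \<open>c > 0\<close> by (auto simp: M_def image_iff)
  show "(C * c)-lipschitz_on {0..T / c} (\<lambda>t. \<psi> (c * t))"
  proof (rule lipschitz_onI)
    show "0 \<le> C * c" using lipschitz_on_nonneg[OF lip] \<open>c > 0\<close> by simp
    show "dist (\<psi> (c * s)) (\<psi> (c * t)) \<le> C * c * dist s t" if "s \<in> {0..T / c}" "t \<in> {0..T / c}" for s t
      using lipschitz_onD[OF lip mem[OF that(1)] mem[OF that(2)]] \<open>c > 0\<close>
      by (simp add: dist_real_def right_diff_distrib[symmetric] abs_mult)
  qed
  show "(\<lambda>t. c * w (c * t)) \<in> borel_measurable (lebesgue_on {0..T / c})"
    by (rule borel_measurable_speed_up) fact+
  show "((\<lambda>t. \<psi> (c * t)) has_real_derivative c * w (c * t)) (at t within {0..T / c})"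
    if "t \<in> {0..T / c} - M" for t
  proof -
    have "(\<psi> has_real_derivative w (c * t)) (at (c * t) within (*) c ` {0..T / c})"
      by (rule DERIV_subset[OF der[OF off[OF that]]]) (use mem in auto)
    moreover have "((*) c has_real_derivative c) (at t within {0..T / c})"
      by (auto intro!: derivative_eq_intros)
    ultimately show ?thesis
      using DERIV_image_chain by (fastforce simp: o_def mult.commute)
  qed
  show "\<bar>c * w (c * t)\<bar> \<le> a" if "t \<in> {0..T / c} - M" for t
    using bound[OF off[OF that]] \<open>c > 0\<close> by (simp add: abs_mult)
  show "[\<psi> (c * 0) = \<theta>0] (rmod (2 * pi))" "[\<psi> (c * (T / c)) = \<theta>f] (rmod (2 * pi))"
    using ends \<open>c > 0\<close> by simp_all
  have "((\<lambda>s. cis (\<psi> s)) has_integral c *\<^sub>R Complex (xf - x0) (yf - y0)) (cbox 0 T)"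
    using disp lipschitz_on_continuous_on[OF lip]
    by (metis box_real(2) continuous_on_cis integrable_continuous_real integrable_integral)
  from has_integral_affinity'[OF this \<open>c > 0\<close>, of 0]
  show "integral {0..T / c} (\<lambda>t. cis (\<psi> (c * t))) = Complex (xf - x0) (yf - y0)"
    using \<open>c > 0\<close> by (intro integral_unique) (simp add: divide_inverse mult.commute)
qed

section \<open>Shortening a curve with curvature slack\<close>

text \<open>
  Bend the curve so slightly that the curvature stays at most \<open>(a + b) / 2\<close> and its displacement
  becomes \<open>c *\<^sub>R \<Delta>\<close> for some \<open>c > 1\<close>, then shrink by the factor
  \<open>c\<close>. The shrunken curve has displacement \<open>\<Delta>\<close> and curvature at most
  \<open>c * (a + b) / 2\<close>, which is below \<open>a\<close> when \<open>c\<close> is close to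
  \<open>1\<close>.
\<close>

lemma shorter_curve_if_curvature_slack:
  assumes con: "dubins_constraints (x0, y0, \<theta>0) (xf, yf, \<theta>f) T b x y \<theta> u"
    and b: "0 \<le> b" "b < a" and not_straight: "norm ((x0, y0) - (xf, yf)) < T"
  shows "\<exists>T' x y \<theta> u. 0 < T' \<and> T' < T \<and> dubins_constraints (x0, y0, \<theta>0) (xf, yf, \<theta>f) T' a x y \<theta> u"
proof -
  define \<Delta> where "\<Delta> = Complex (xf - x0) (yf - y0)"
  have "T > 0" using not_straight norm_ge_zero le_less_trans by blast
  have "norm \<Delta> < T"
    using not_straight by (simp add: \<Delta>_def norm_Pair complex_norm power2_commute)
  obtain N where N: "negligible N"
    and der: "\<And>t. t \<in> {0..T} - N \<Longrightarrow> (\<theta> has_real_derivative u t) (at t within {0..T})"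
    and bound: "\<And>t. t \<in> {0..T} - N \<Longrightarrow> \<bar>u t\<bar> \<le> b"
    and lip: "b-lipschitz_on {0..T} \<theta>"
    and disp: "integral {0..T} (\<lambda>t. cis (\<theta> t)) = \<Delta>"
    using dubins_trajectory_heading[OF con \<open>T > 0\<close> b(1)] unfolding \<Delta>_def by metis
  have u: "u \<in> borel_measurable (lebesgue_on {0..T})"
    and ends: "[\<theta> 0 = \<theta>0] (rmod (2 * pi))" "[\<theta> T = \<theta>f] (rmod (2 * pi))"
    using con by (auto simp: dubins_constraints_def Linfty_on_def)
  have cont: "continuous_on {0..T} \<theta>" using lip by (rule lipschitz_on_continuous_on)
  define M where "M = T + T\<^sup>2 * b"
  have "M > 0" using \<open>T > 0\<close> b(1) by (simp add: M_def add_pos_nonneg)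
  (* A bend with norm v < r adds at most M * r = (a - b) / 2 to the curvature. *)
  define r where "r = (a - b) / (2 * M)"
  have "r > 0" using b \<open>M > 0\<close> by (simp add: r_def)
  have "\<Delta> \<in> interior (bent_displacement T \<theta> ` ball 0 r)"
    using bent_displacement_interior[OF \<open>T > 0\<close> cont _ \<open>r > 0\<close>] disp \<open>norm \<Delta> < T\<close> by simp
  moreover have "((\<lambda>c. c *\<^sub>R \<Delta>) \<longlongrightarrow> 1 *\<^sub>R \<Delta>) (at_right 1)"
    by (intro tendsto_intros)
  ultimately have "\<forall>\<^sub>F c in at_right 1. c *\<^sub>R \<Delta> \<in> interior (bent_displacement T \<theta> ` ball 0 r)"
    by (intro topological_tendstoD) auto
  moreover have "((\<lambda>c. c * ((a + b) / 2)) \<longlongrightarrow> 1 * ((a + b) / 2)) (at_right 1)"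
    by (intro tendsto_intros)
  then have "\<forall>\<^sub>F c in at_right 1. c * ((a + b) / 2) < a"
    by (rule order_tendstoD(2)) (use b in simp)
  moreover have "\<forall>\<^sub>F c in at_right 1. c > (1::real)"
    by (rule eventually_at_right_less)
  ultimately have "\<forall>\<^sub>F c in at_right 1. c *\<^sub>R \<Delta> \<in> interior (bent_displacement T \<theta> ` ball 0 r)
      \<and> c * ((a + b) / 2) < a \<and> c > 1"
    by (intro eventually_conj)
  then obtain c where c: "c *\<^sub>R \<Delta> \<in> interior (bent_displacement T \<theta> ` ball 0 r)"
      "c * ((a + b) / 2) < a" "c > 1"
    using eventually_happens'[OF trivial_limit_at_right_real] by blast
  then obtain v where v: "norm v < r" "bent_displacement T \<theta> v = c *\<^sub>R \<Delta>"
    using interior_subset by (fastforce simp: dist_norm)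
  have "M * norm v \<le> (a - b) / 2"
    using v(1) \<open>M > 0\<close> by (simp add: r_def field_simps)
  then have slack: "b + M * norm v \<le> (a + b) / 2" by (simp add: field_simps)
  have "\<exists>x y. dubins_constraints (x0, y0, \<theta>0) (xf, yf, \<theta>f) (T / c) a x y
      (\<lambda>t. \<theta> (c * t) + bend T \<theta> v (c * t)) (\<lambda>t. c * bent_control T \<theta> u v (c * t))"
  proof (rule dubins_constraints_speed_up[OF _ \<open>T > 0\<close> lipschitz_on_bent_heading[OF lip] N
        borel_measurable_bent_control[OF u cont] has_real_derivative_bent_heading])
    show "c > 0" "T \<ge> 0" using c \<open>T > 0\<close> by simp_all
    show "(\<theta> has_real_derivative u s) (at s within {0..T})" if "s \<in> {0..T} - N" for s
      using that by (rule der)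
    show "c * \<bar>bent_control T \<theta> u v s\<bar> \<le> a" if "s \<in> {0..T} - N" for s
    proof -
      have "\<bar>bent_control T \<theta> u v s\<bar> \<le> (a + b) / 2"
        using abs_bent_control_le[of s T u b \<theta> v] bound[OF that] that slack by (auto simp: M_def)
      then have "c * \<bar>bent_control T \<theta> u v s\<bar> \<le> c * ((a + b) / 2)"
        using c(3) by (intro mult_left_mono) auto
      then show ?thesis using c(2) by simp
    qed
    show "[\<theta> 0 + bend T \<theta> v 0 = \<theta>0] (rmod (2 * pi))" "[\<theta> T + bend T \<theta> v T = \<theta>f] (rmod (2 * pi))"
      using ends by simp_all
    show "integral {0..T} (\<lambda>s. cis (\<theta> s + bend T \<theta> v s)) = c *\<^sub>R Complex (xf - x0) (yf - y0)"
      using v(2) by (simp add: bent_displacement_def \<Delta>_def)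
  qed
  moreover have "0 < T / c" "T / c < T" using \<open>T > 0\<close> c(3) by (auto simp: field_simps)
  ultimately show ?thesis by blast
qed

theorem theorem4:
  fixes x0 y0 \<theta>0 xf yf \<theta>f a tf :: real
  assumes "a > 0"
    and "tf > norm ((x0, y0) - (xf, yf))"
    and "MD_solution (x0, y0, \<theta>0) (xf, yf, \<theta>f) a tf"
  shows "Pc_solution (x0, y0, \<theta>0) (xf, yf, \<theta>f) tf a"
proof -
  let ?p0 = "(x0, y0, \<theta>0)" and ?pf = "(xf, yf, \<theta>f)"
  from assms(3) obtain u where feasible: "MD_feasible ?p0 ?pf a (tf, u)"
    and shortest: "\<And>z. MD_feasible ?p0 ?pf a z \<Longrightarrow> \<not> fst z < tf"
    unfolding MD_solution_def is_arg_min_def by (metis fst_conv)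
  have "\<not> b < a" if less: "Pc_feasible ?p0 ?pf tf (b, w)" for b w
  proof
    assume "b < a"
    from less obtain x y \<theta> where "b \<ge> 0" "dubins_constraints ?p0 ?pf tf b x y \<theta> w"
      by (auto simp: Pc_feasible_def)
    from shorter_curve_if_curvature_slack[OF this(2,1) \<open>b < a\<close> assms(2)]
    obtain T' x' y' \<theta>' u' where T': "0 < T'" "T' < tf" "dubins_constraints ?p0 ?pf T' a x' y' \<theta>' u'"
      by blast
    then have "MD_feasible ?p0 ?pf a (T', u')"
      by (auto simp: MD_feasible_def)
    with shortest T'(2) show False by fastforce
  qed
  moreover have "Pc_feasible ?p0 ?pf tf (a, u)"
    using feasible \<open>a > 0\<close> by (auto simp: Pc_feasible_def MD_feasible_def)
  ultimately show ?thesis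
    by (auto simp: Pc_solution_def is_arg_min_def)
qed

end
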